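(* Let $G$ be a countable ICC group and let $\pi:G\to\mathcal U(\mathcal H)$ be a unitary representation of $G$ on the Hilbert space $\mathcal H$. Let $\xi_1\in\mathcal H$ be a Parseval frame vector for $\mathcal H$, $\mathcal H\neq\{0\}$, let $N:=\lfloor 1/\|\xi_1\|^2\rfloor$, and let $\xi_1,\dots,\xi_{N+1}\in\mathcal H$ be a strongly disjoint $(N+1)$-tuple of Parseval frame vectors such that $\xi_1,\dots,\xi_N$ are Parseval frame vectors for $\mathcal H$, $\|\xi_{N+1}\|^2=1-N\|\xi_1\|^2$, and $\xi_{N+1}$ is a Parseval frame vector for $p_r'\mathcal H$, where $p_r'\in\pi(G)'$ is a projection. Let $\eta,\zeta\in\mathcal H$ be two Parseval frame vectors for some subspaces of $\mathcal H$. Suppose $$\eta=u_1'\xi_1+\dots+u_{N+1}'\xi_{N+1},\qquad \zeta=v_1'\xi_1+\dots+v_{N+1}'\xi_{N+1},$$ with $u_i',v_i'\in\pi(G)'$, $i=1,\dots,N+1$, $u_{N+1}'p_r'=u_{N+1}'$ and $v_{N+1}'p_r'=v_{N+1}'$. Then: (i) $\eta$ and $\zeta$ are strongly disjoint if and only if $$v_1'u_1'^*+\dots+v_{N+1}'u_{N+1}'^*=0.$$ (ii) $\eta$ and $\zeta$ are unitarily equivalent if and only if $$[u_1'^*,\dots,u_{N+1}'^*]^t\,[u_1',\dots,u_{N+1}']=[v_1'^*,\dots,v_{N+1}'^*]^t\,[v_1',\dots,v_{N+1}'],$$ where $t$ denotes the transpose of the row vector (so this is an equality of $(N+1)\times(N+1)$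 operator matrices with $(i,j)$ entries $u_i'^*u_j'$ and $v_i'^*v_j'$).
   Context: A group $G$ is ICC if for every $g\ne e$ in $G$ the conjugacy class of $g$ is infinite. A family $\{e_i\,|\,i\in I\}$ in a Hilbert space $\mathcal K$ is a Parseval frame for $\mathcal K$ if $\|f\|^2=\sum_{i\in I}|\langle f,e_i\rangle|^2$ for all $f\in\mathcal K$. A vector $\xi\in\mathcal H$ is a Parseval frame vector for a closed subspace $\mathcal K\subseteq\mathcal H$ (possibly $\mathcal K=\mathcal H$) if $\{\pi(g)\xi\,|\,g\in G\}$ (indexed by $G$) is contained in $\mathcal K$ and is a Parseval frame for $\mathcal K$ (so $\mathcal K$ is its closed linear span). Parseval frames $\{e_i^1\},\dots,\{e_i^n\}$ ($i\in I$) for Hilbert spaces $\mathcal H_1,\dots,\mathcal H_n$ form a strongly disjoint $n$-tuple if $\{e_i^1\oplus\dots\oplus e_i^n\,|\,i\in I\}$ is a Parseval frame for $\mathcal H_1\oplus\dots\oplus\mathcal H_n$ (strongly disjoint when $n=2$). Parseval frames $\{e_i\}$, $\{f_i\}$ ($i\in I$) for $\mathcal H_1,\mathcal H_2$ are unitarily equivalent if there is a unitary $U:\mathcal H_1\to\mathcal H_2$ with $Ue_i=f_i$ for all $i\in I$. Parseval frame vectors are strongly disjoint / form a strongly disjoint $n$-tuple / are unitarily equivalent if the Parseval frames indexed by $G$ which they generate (for the subspaces they span) have this property. $\pi(G)'$ is the commutant of $\pi(G)$. "Projection" means orthogonal projection. *)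

theory Defs
  imports "HOL-Analysis.Analysis" "HOL-Algebra.Group"
begin

section \<open>Complex Hilbert spaces\<close>

text \<open>The real inner product, hence the norm and the topology, of \<^class>\<open>real_inner\<close> is required to
  be the real part of the complex one; positive definiteness of \<open>cinner\<close> and
  \<open>(norm x)\<^sup>2 = Re (cinner x x)\<close> follow.  The inner product is linear in the first argument.\<close>

class chilbert_space = real_inner + complete_space +
  fixes scaleC :: "complex \<Rightarrow> 'a \<Rightarrow> 'a"  (infixr \<open>*\<^sub>C\<close> 75)
    and cinner :: "'a \<Rightarrow> 'a \<Rightarrow> complex"
  assumes scaleC_add_right: "a *\<^sub>C (x + y) = a *\<^sub>C x + a *\<^sub>C y"
    and scaleC_add_left: "(a + b) *\<^sub>C x = a *\<^sub>C x + b *\<^sub>C x"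
    and scaleC_scaleC: "a *\<^sub>C (b *\<^sub>C x) = (a * b) *\<^sub>C x"
    and scaleR_scaleC: "r *\<^sub>R x = complex_of_real r *\<^sub>C x"
    and cinner_commute: "cinner x y = cnj (cinner y x)"
    and cinner_add_left: "cinner (x + y) z = cinner x z + cinner y z"
    and cinner_scaleC_left: "cinner (a *\<^sub>C x) y = a * cinner x y"
    and inner_Re_cinner: "inner x y = Re (cinner x y)"

instantiation complex :: chilbert_space
begin

definition scaleC_complex :: "complex \<Rightarrow> complex \<Rightarrow> complex" where
  "scaleC_complex a x = a * x"

definition cinner_complex :: "complex \<Rightarrow> complex \<Rightarrow> complex" where
  "cinner_complex x y = x * cnj y"

instance
  by standard
    (simp_all add: scaleC_complex_def cinner_complex_def inner_complex_def algebra_simps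
      scaleR_conv_of_real)

end

definition closed_csubspace :: "'h::chilbert_space set \<Rightarrow> bool" where
  "closed_csubspace K \<longleftrightarrow> subspace K \<and> (\<forall>a. \<forall>x\<in>K. a *\<^sub>C x \<in> K) \<and> closed K"

definition closed_cspan :: "'h::chilbert_space set \<Rightarrow> 'h set" where
  "closed_cspan S = \<Inter>{K. closed_csubspace K \<and> S \<subseteq> K}"

definition bounded_clinear :: "('h::chilbert_space \<Rightarrow> 'h) \<Rightarrow> bool" where
  "bounded_clinear T \<longleftrightarrow> bounded_linear T \<and> (\<forall>a x. T (a *\<^sub>C x) = a *\<^sub>C T x)"

text \<open>For bounded \<open>T\<close> the operator described exists and is unique (Riesz).\<close>

definition cadjoint :: "('h::chilbert_space \<Rightarrow> 'h) \<Rightarrow> 'h \<Rightarrow> 'h" where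
  "cadjoint T = (THE S. \<forall>x y. cinner (T x) y = cinner x (S y))"

definition orth_projection :: "('h::chilbert_space \<Rightarrow> 'h) \<Rightarrow> bool" where
  "orth_projection p \<longleftrightarrow> bounded_clinear p \<and> p \<circ> p = p \<and> cadjoint p = p"

text \<open>Unitary operators from the closed subspace \<open>K\<close> onto the closed subspace \<open>L\<close>; values outside
  \<open>K\<close> are irrelevant.\<close>

definition unitary_on :: "'h::chilbert_space set \<Rightarrow> 'k::chilbert_space set \<Rightarrow> ('h \<Rightarrow> 'k) \<Rightarrow> bool" where
  "unitary_on K L U \<longleftrightarrow>
     (\<forall>x\<in>K. \<forall>y\<in>K. U (x + y) = U x + U y) \<and>
     (\<forall>a. \<forall>x\<in>K. U (a *\<^sub>C x) = a *\<^sub>C U x) \<and>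
     (\<forall>x\<in>K. \<forall>y\<in>K. cinner (U x) (U y) = cinner x y) \<and>
     U ` K = L"


section \<open>Groups and unitary representations\<close>

definition icc_group :: "('g, 'm) monoid_scheme \<Rightarrow> bool" where
  "icc_group G \<longleftrightarrow> group G \<and>
     (\<forall>g\<in>carrier G. g \<noteq> \<one>\<^bsub>G\<^esub> \<longrightarrow> infinite {x \<otimes>\<^bsub>G\<^esub> g \<otimes>\<^bsub>G\<^esub> inv\<^bsub>G\<^esub> x | x. x \<in> carrier G})"

definition unitary_group :: "('h::chilbert_space \<Rightarrow> 'h) monoid" where
  "unitary_group = \<lparr>carrier = {U. unitary_on UNIV UNIV U}, mult = (\<circ>), one = id\<rparr>"

definition commutant ::
    "('g, 'm) monoid_scheme \<Rightarrow> ('g \<Rightarrow> 'h::chilbert_space \<Rightarrow> 'h) \<Rightarrow> ('h \<Rightarrow> 'h) set" where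
  "commutant G \<pi> = {T. bounded_clinear T \<and> (\<forall>g\<in>carrier G. T \<circ> \<pi> g = \<pi> g \<circ> T)}"


section \<open>Parseval frames\<close>

text \<open>The inner product \<open>ip\<close> is a parameter so that the definition applies both to closed subspaces of
  a Hilbert space (with \<^const>\<open>cinner\<close>) and to direct sums (with \<open>cinner_sum\<close> below);
  \<open>Re (ip f f)\<close> is the squared norm of \<open>f\<close>.\<close>

definition parseval_frame ::
    "('v \<Rightarrow> 'v \<Rightarrow> complex) \<Rightarrow> 'v set \<Rightarrow> 'i set \<Rightarrow> ('i \<Rightarrow> 'v) \<Rightarrow> bool" where
  "parseval_frame ip K I e \<longleftrightarrow>
     e ` I \<subseteq> K \<and>
     (\<forall>f\<in>K. ((\<lambda>i. (cmod (ip f (e i)))\<^sup>2) has_sum Re (ip f f)) I)"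

text \<open>The direct sum of closed subspaces \<open>K 1, \<dots>, K n\<close>, its elements being the tuples
  \<open>f 1 \<oplus> \<dots> \<oplus> f n\<close> represented as extensional functions on \<open>{1..n}\<close>.\<close>

definition direct_sum :: "nat \<Rightarrow> (nat \<Rightarrow> 'h set) \<Rightarrow> (nat \<Rightarrow> 'h::chilbert_space) set" where
  "direct_sum n K = (\<Pi>\<^sub>E k\<in>{1..n}. K k)"

definition cinner_sum :: "nat \<Rightarrow> (nat \<Rightarrow> 'h::chilbert_space) \<Rightarrow> (nat \<Rightarrow> 'h) \<Rightarrow> complex" where
  "cinner_sum n f g = (\<Sum>k=1..n. cinner (f k) (g k))"

text \<open>\<open>e k\<close> is the \<open>k\<close>-th frame, a Parseval frame indexed by \<open>I\<close> for \<open>K k\<close>.\<close>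

definition strongly_disjoint_frames ::
    "nat \<Rightarrow> (nat \<Rightarrow> 'h::chilbert_space set) \<Rightarrow> 'i set \<Rightarrow> (nat \<Rightarrow> 'i \<Rightarrow> 'h) \<Rightarrow> bool" where
  "strongly_disjoint_frames n K I e \<longleftrightarrow>
     (\<forall>k\<in>{1..n}. closed_csubspace (K k) \<and> parseval_frame cinner (K k) I (e k)) \<and>
     parseval_frame (cinner_sum n) (direct_sum n K) I (\<lambda>i. \<lambda>k\<in>{1..n}. e k i)"

definition unitarily_equivalent_frames ::
    "'h::chilbert_space set \<Rightarrow> 'k::chilbert_space set \<Rightarrow> 'i set \<Rightarrow> ('i \<Rightarrow> 'h) \<Rightarrow> ('i \<Rightarrow> 'k) \<Rightarrow> bool" where
  "unitarily_equivalent_frames K L I e f \<longleftrightarrow>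
     closed_csubspace K \<and> parseval_frame cinner K I e \<and>
     closed_csubspace L \<and> parseval_frame cinner L I f \<and>
     (\<exists>U. unitary_on K L U \<and> (\<forall>i\<in>I. U (e i) = f i))"


section \<open>Parseval frame vectors\<close>

definition parseval_frame_vector ::
    "('g, 'm) monoid_scheme \<Rightarrow> ('g \<Rightarrow> 'h::chilbert_space \<Rightarrow> 'h) \<Rightarrow> 'h set \<Rightarrow> 'h \<Rightarrow> bool" where
  "parseval_frame_vector G \<pi> K \<xi> \<longleftrightarrow>
     closed_csubspace K \<and> parseval_frame cinner K (carrier G) (\<lambda>g. \<pi> g \<xi>)"

definition orbit_space ::
    "('g, 'm) monoid_scheme \<Rightarrow> ('g \<Rightarrow> 'h::chilbert_space \<Rightarrow> 'h) \<Rightarrow> 'h \<Rightarrow> 'h set" where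
  "orbit_space G \<pi> \<xi> = closed_cspan ((\<lambda>g. \<pi> g \<xi>) ` carrier G)"

definition strongly_disjoint_tuple ::
    "('g, 'm) monoid_scheme \<Rightarrow> ('g \<Rightarrow> 'h::chilbert_space \<Rightarrow> 'h) \<Rightarrow> nat \<Rightarrow> (nat \<Rightarrow> 'h) \<Rightarrow> bool" where
  "strongly_disjoint_tuple G \<pi> n \<xi> \<longleftrightarrow>
     strongly_disjoint_frames n (\<lambda>k. orbit_space G \<pi> (\<xi> k)) (carrier G) (\<lambda>k g. \<pi> g (\<xi> k))"

definition strongly_disjoint ::
    "('g, 'm) monoid_scheme \<Rightarrow> ('g \<Rightarrow> 'h::chilbert_space \<Rightarrow> 'h) \<Rightarrow> 'h \<Rightarrow> 'h \<Rightarrow> bool" where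
  "strongly_disjoint G \<pi> \<eta> \<zeta> \<longleftrightarrow>
     strongly_disjoint_tuple G \<pi> 2 (\<lambda>k. if k = 1 then \<eta> else \<zeta>)"

definition unitarily_equivalent ::
    "('g, 'm) monoid_scheme \<Rightarrow> ('g \<Rightarrow> 'h::chilbert_space \<Rightarrow> 'h) \<Rightarrow> 'h \<Rightarrow> 'h \<Rightarrow> bool" where
  "unitarily_equivalent G \<pi> \<eta> \<zeta> \<longleftrightarrow>
     unitarily_equivalent_frames (orbit_space G \<pi> \<eta>) (orbit_space G \<pi> \<zeta>) (carrier G)
       (\<lambda>g. \<pi> g \<eta>) (\<lambda>g. \<pi> g \<zeta>)"

end

theory Submission
  imports Defs
begin

text \<open>
  Both equivalences are statements about finitely many strongly disjoint Parseval frames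
  \<open>e\<^sub>1, \<dots>, e\<^sub>n\<close> of closed subspaces \<open>K\<^sub>1, \<dots>, K\<^sub>n\<close>, here the orbits of the \<open>\<xi>\<^sub>k\<close>.  Strong
  disjointness says that \<open>\<Theta>(f\<^sub>1 \<oplus> \<dots> \<oplus> f\<^sub>n) = (\<Sum>\<^sub>k \<langle>f\<^sub>k, e\<^sub>k(i)\<rangle>)\<^sub>i\<close> is an isometry from the direct sum
  into \<open>\<ell>\<^sup>2\<close>.  As the \<open>u\<^sub>k\<close> commute with \<open>\<pi>(g)\<close>, the orbit \<open>E\<close> of \<open>\<eta>\<close> satisfies
  \<open>E(i) = \<Sum>\<^sub>k u\<^sub>k e\<^sub>k(i)\<close>, and the orbit \<open>F\<close> of \<open>\<zeta>\<close> likewise with the \<open>v\<^sub>k\<close>; since the adjoint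
  \<open>u\<^sub>k\<^sup>*\<close> takes values in \<open>K\<^sub>k\<close> (this is what \<open>u\<^sub>N\<^sub>+\<^sub>1 p = u\<^sub>N\<^sub>+\<^sub>1\<close> provides for the last index; the other
  \<open>K\<^sub>k\<close> are the whole space), the
  frame coefficients of \<open>x\<close> with respect to \<open>E\<close> are \<open>\<Theta>(u\<^sub>1\<^sup>* x \<oplus> \<dots> \<oplus> u\<^sub>n\<^sup>* x)\<close>.  So sums over the
  index set become finite sums over \<open>k\<close>, and the proof is algebra with the operators
  \<open>W = \<Sum>\<^sub>k v\<^sub>k u\<^sub>k\<^sup>*\<close> (\<open>cross_operator\<close>).  Write \<open>L\<close> and \<open>M\<close> for the spaces spanned by \<open>E\<close> and \<open>F\<close>.

  For (i): the squared norm of the coefficient sequence of \<open>x \<oplus> y\<close> is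
  \<open>\<parallel>x\<parallel>\<^sup>2 + \<parallel>y\<parallel>\<^sup>2 + 2 Re \<langle>W x, y\<rangle>\<close> for \<open>x \<in> L\<close> and \<open>y \<in> M\<close> (\<open>sum_frame_coefficients\<close>), so \<open>E\<close> and \<open>F\<close> are
  strongly disjoint iff the last term vanishes for all such \<open>x\<close> and \<open>y\<close>.  This means \<open>W = 0\<close>, because
  \<open>W\<close> maps into \<open>M\<close> and vanishes on the orthogonal complement of \<open>L\<close>.

  For (ii): a unitary with \<open>E(i) \<mapsto> F(i)\<close> makes the Gram matrices of \<open>E\<close> and \<open>F\<close> equal.  Injectivity of \<open>\<Theta>\<close>,
  used once for each index of the Gram matrix, turns this into \<open>u\<^sub>k\<^sup>* u\<^sub>l = v\<^sub>k\<^sup>* v\<^sub>l\<close>.  Conversely \<open>W\<close>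
  itself is the required unitary: \<open>\<Sum>\<^sub>k u\<^sub>k u\<^sub>k\<^sup>*\<close> and \<open>\<Sum>\<^sub>k v\<^sub>k v\<^sub>k\<^sup>*\<close> are the projections onto \<open>L\<close> and \<open>M\<close>
  (\<open>cross_operator_self\<close>), and equality of the operator matrices reduces \<open>W\<^sup>* W\<close>, \<open>W W\<^sup>*\<close> and \<open>W E(i)\<close> to
  these projections.
\<close>

section \<open>Orthogonal projection and Riesz representation\<close>

lemma closest_point_in_closed_subspace:
  fixes K :: "'a::{real_inner,complete_space} set" and x :: 'a
  assumes K: "subspace K" "closed K"
  obtains y where "y \<in> K" "\<And>z. z \<in> K \<Longrightarrow> norm (x - y) \<le> norm (x - z)"
proof -
  define S where "S = (\<lambda>z. (norm (x - z))\<^sup>2) ` K"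
  define D where "D = Inf S"
  have S_ne: "S \<noteq> {}" using subspace_0[OF K(1)] by (auto simp: S_def)
  have S_bdd: "bdd_below S" by (rule bdd_belowI[of _ 0]) (auto simp: S_def)
  have D_le: "D \<le> (norm (x - z))\<^sup>2" if "z \<in> K" for z
    unfolding D_def using that S_bdd by (intro cInf_lower) (auto simp: S_def)
  have "\<exists>z\<in>K. (norm (x - z))\<^sup>2 < D + inverse (real (Suc n))" for n
  proof -
    have "\<exists>s\<in>S. s < D + inverse (real (Suc n))"
      using cInf_lessD[OF S_ne, of "D + inverse (real (Suc n))"] by (auto simp: D_def)
    then show ?thesis by (auto simp: S_def)
  qed
  then obtain y where y: "\<And>n. y n \<in> K"
      and y_near: "\<And>n. (norm (x - y n))\<^sup>2 < D + inverse (real (Suc n))"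
    by metis
  (* Midpoints stay in K, so the parallelogram law bounds the distance of two near-minimisers. *)
  have y_dist: "(norm (y m - y n))\<^sup>2 \<le> 2 * inverse (real (Suc m)) + 2 * inverse (real (Suc n))"
    for m n
  proof -
    have "(1/2) *\<^sub>R (y m + y n) \<in> K"
      using K(1) y by (intro subspace_scale subspace_add)
    then have "D \<le> (norm (x - (1/2) *\<^sub>R (y m + y n)))\<^sup>2" by (rule D_le)
    moreover have "(norm (y m - y n))\<^sup>2 + 4 * (norm (x - (1/2) *\<^sub>R (y m + y n)))\<^sup>2
        = 2 * (norm (x - y m))\<^sup>2 + 2 * (norm (x - y n))\<^sup>2"
      unfolding power2_norm_eq_inner
      by (simp add: inner_diff_left inner_diff_right inner_add_left inner_add_right
          inner_commute algebra_simps)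
    ultimately show ?thesis using y_near[of m] y_near[of n] by simp
  qed
  have "Cauchy y"
  proof (rule metric_CauchyI)
    fix \<epsilon> :: real assume "\<epsilon> > 0"
    then have "\<epsilon>\<^sup>2 / 4 > 0" by simp
    then obtain M where M: "inverse (real (Suc M)) < \<epsilon>\<^sup>2 / 4"
      using reals_Archimedean by blast
    have small: "inverse (real (Suc m)) < \<epsilon>\<^sup>2 / 4" if "m \<ge> M" for m
    proof -
      have "inverse (real (Suc m)) \<le> inverse (real (Suc M))"
        using that by (intro le_imp_inverse_le) auto
      then show ?thesis using M by (rule le_less_trans)
    qed
    have "dist (y m) (y n) < \<epsilon>" if "m \<ge> M" "n \<ge> M" for m n
    proof -
      have "(norm (y m - y n))\<^sup>2 < \<epsilon>\<^sup>2"
        using y_dist[of m n] small[OF that(1)] small[OF that(2)] by simp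
      then show ?thesis
        using \<open>\<epsilon> > 0\<close> by (simp add: dist_norm power2_less_imp_less)
    qed
    then show "\<exists>M. \<forall>m\<ge>M. \<forall>n\<ge>M. dist (y m) (y n) < \<epsilon>" by blast
  qed
  then obtain l where l: "y \<longlonglongrightarrow> l"
    using Cauchy_convergent_iff convergent_def by blast
  have "l \<in> K" using K(2) y l by (rule closed_sequentially)
  have "(\<lambda>n. (norm (x - y n))\<^sup>2) \<longlonglongrightarrow> (norm (x - l))\<^sup>2"
    by (intro tendsto_intros l)
  moreover have "(\<lambda>n. D + inverse (real (Suc n))) \<longlonglongrightarrow> D + 0"
    by (intro tendsto_intros LIMSEQ_inverse_real_of_nat)
  moreover have "\<exists>M. \<forall>n\<ge>M. (norm (x - y n))\<^sup>2 \<le> D + inverse (real (Suc n))"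
    using y_near less_imp_le by blast
  ultimately have "(norm (x - l))\<^sup>2 \<le> D + 0" by (rule LIMSEQ_le)
  then have "(norm (x - l))\<^sup>2 \<le> D" by simp
  then have "norm (x - l) \<le> norm (x - z)" if "z \<in> K" for z
    using D_le[OF that] norm_ge_zero[of "x - z"] power2_le_imp_le order_trans by blast
  with \<open>l \<in> K\<close> show ?thesis by (rule that)
qed

lemma orthogonal_decomposition:
  fixes K :: "'a::{real_inner,complete_space} set" and x :: 'a
  assumes K: "subspace K" "closed K"
  obtains y where "y \<in> K" "\<And>z. z \<in> K \<Longrightarrow> inner (x - y) z = 0"
proof -
  obtain y where y: "y \<in> K" "\<And>z. z \<in> K \<Longrightarrow> norm (x - y) \<le> norm (x - z)"
    using closest_point_in_closed_subspace[OF K, of x] by blast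
  have "inner (x - y) z = 0" if z: "z \<in> K" for z
  proof (cases "z = 0")
    case False
    (* The competitor y + t z, with the t that minimises the distance to x. *)
    define t where "t = inner (x - y) z / inner z z"
    have zz: "inner z z > 0" using False by simp
    have "y + t *\<^sub>R z \<in> K" using K(1) y(1) z by (intro subspace_add subspace_scale)
    then have "(norm (x - y))\<^sup>2 \<le> (norm (x - (y + t *\<^sub>R z)))\<^sup>2"
      using y(2) by (intro power_mono) auto
    also have "x - (y + t *\<^sub>R z) = (x - y) - t *\<^sub>R z" by simp
    also have "(norm ((x - y) - t *\<^sub>R z))\<^sup>2
        = (norm (x - y))\<^sup>2 - 2 * t * inner (x - y) z + t\<^sup>2 * inner z z"
      unfolding power2_norm_eq_inner
      by (simp add: inner_diff_left[of "x - y"] inner_diff_right[of _ "x - y"] inner_commute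
          power2_eq_square)
    also have "\<dots> = (norm (x - y))\<^sup>2 - (inner (x - y) z)\<^sup>2 / inner z z"
      using zz by (simp add: t_def power2_eq_square)
    finally have "(inner (x - y) z)\<^sup>2 / inner z z \<le> 0" by simp
    then show ?thesis using zz by (simp add: divide_le_0_iff)
  qed simp
  with y(1) show ?thesis by (rule that)
qed

text \<open>The kernel of \<open>f \<noteq> 0\<close> has codimension one, so a vector \<open>w\<close> orthogonal to it with \<open>f w \<noteq> 0\<close>
  represents \<open>f\<close> up to a scalar.\<close>

lemma riesz_representation_real:
  fixes f :: "'a::{real_inner,complete_space} \<Rightarrow> real"
  assumes "bounded_linear f"
  obtains z where "\<And>x. f x = inner x z"
proof (cases "\<forall>x. f x = 0")
  case True
  then show ?thesis by (intro that[of 0]) simp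
next
  case False
  then obtain x0 where x0: "f x0 \<noteq> 0" by blast
  interpret f: bounded_linear f by (rule assms)
  have "{x. f x = 0} = f -` {0}" by auto
  moreover have "closed (f -` {0})"
    using f.continuous_on[OF continuous_on_id] by (intro closed_vimage) auto
  ultimately have "closed {x. f x = 0}" by simp
  moreover have "subspace {x. f x = 0}"
    by (auto simp: subspace_def f.add f.scaleR f.zero)
  ultimately obtain y where y: "f y = 0" "\<And>z. f z = 0 \<Longrightarrow> inner (x0 - y) z = 0"
    using orthogonal_decomposition[of "{x. f x = 0}" x0] by auto
  define w where "w = x0 - y"
  have fw: "f w \<noteq> 0" using x0 y(1) by (simp add: w_def f.diff)
  then have ww: "inner w w \<noteq> 0" by (auto simp: f.zero)
  show ?thesis
  proof (rule that[of "(f w / inner w w) *\<^sub>R w"])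
    fix x
    have "f (x - (f x / f w) *\<^sub>R w) = 0" using fw by (simp add: f.diff f.scaleR)
    then have "inner w (x - (f x / f w) *\<^sub>R w) = 0" using y(2) by (simp add: w_def)
    then have "inner w x = f x / f w * inner w w" by (simp add: inner_diff_right)
    then show "f x = inner x ((f w / inner w w) *\<^sub>R w)"
      using fw ww by (simp add: inner_commute)
  qed
qed

section \<open>The complex inner product and adjoints\<close>

lemma cinner_add_right:
  "cinner x (y + z) = cinner x y + cinner x (z :: 'h::chilbert_space)"
  by (metis cinner_add_left cinner_commute complex_cnj_add)

lemma cinner_scaleC_right: "cinner x (a *\<^sub>C y) = cnj a * cinner x (y :: 'h::chilbert_space)"
  by (metis cinner_commute cinner_scaleC_left complex_cnj_mult)

lemma cinner_zero_left [simp]: "cinner 0 (x :: 'h::chilbert_space) = 0"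
  using cinner_add_left[of 0 0 x] by simp

lemma cinner_zero_right [simp]: "cinner (x :: 'h::chilbert_space) 0 = 0"
  using cinner_add_right[of x 0 0] by simp

lemma cinner_minus_left: "cinner (- x) (y :: 'h::chilbert_space) = - cinner x y"
  using cinner_add_left[of x "- x" y] by (simp add: add_eq_0_iff)

lemma cinner_minus_right: "cinner x (- y :: 'h::chilbert_space) = - cinner x y"
  using cinner_add_right[of x y "- y"] by (simp add: add_eq_0_iff)

lemma cinner_diff_left: "cinner (x - y) (z :: 'h::chilbert_space) = cinner x z - cinner y z"
  using cinner_add_left[of x "- y" z] by (simp add: cinner_minus_left)

lemma cinner_diff_right: "cinner x (y - z :: 'h::chilbert_space) = cinner x y - cinner x z"
  using cinner_add_right[of x y "- z"] by (simp add: cinner_minus_right)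

lemma cinner_sum_left: "cinner (sum f A) (x :: 'h::chilbert_space) = (\<Sum>a\<in>A. cinner (f a) x)"
  by (induction A rule: infinite_finite_induct) (simp_all add: cinner_add_left)

lemma cinner_sum_right: "cinner (x :: 'h::chilbert_space) (sum f A) = (\<Sum>a\<in>A. cinner x (f a))"
  by (induction A rule: infinite_finite_induct) (simp_all add: cinner_add_right)

lemma cinner_self: "cinner x (x :: 'h::chilbert_space) = complex_of_real ((norm x)\<^sup>2)"
proof (rule complex_eqI)
  show "Re (cinner x x) = Re (complex_of_real ((norm x)\<^sup>2))"
    by (simp add: inner_Re_cinner[symmetric] power2_norm_eq_inner)
  have "Im (cinner x x) = Im (cnj (cinner x x))" by (metis cinner_commute)
  then show "Im (cinner x x) = Im (complex_of_real ((norm x)\<^sup>2))" by simp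
qed

lemma Re_cinner_self: "Re (cinner x (x :: 'h::chilbert_space)) = (norm x)\<^sup>2"
  by (simp add: cinner_self)

text \<open>Complex linearity recovers the imaginary part: \<open>Im \<langle>x, y\<rangle> = Re \<langle>- \<i> x, y\<rangle>\<close>.\<close>

lemma cinner_eq_from_Re:
  assumes "\<And>a. Re (cinner (a *\<^sub>C x) y) = Re (cinner (a *\<^sub>C x') (y' :: 'h::chilbert_space))"
  shows "cinner x y = cinner x' y'"
  using assms[of 1] assms[of "- \<i>"] by (intro complex_eqI) (simp_all add: cinner_scaleC_left)

lemma cinner_ext_left:
  assumes "\<And>y. cinner x y = cinner x' (y :: 'h::chilbert_space)"
  shows "x = x'"
proof -
  have "cinner (x - x') (x - x') = 0" by (simp add: cinner_diff_left assms)
  then show ?thesis by (simp add: cinner_self)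
qed

lemma cinner_ext_right:
  assumes "\<And>x. cinner x y = cinner x (y' :: 'h::chilbert_space)"
  shows "y = y'"
  by (rule cinner_ext_left) (metis assms cinner_commute)

text \<open>The decomposition for the real inner product serves the complex one as well: a complex
  subspace contains \<open>\<i> z\<close> along with \<open>z\<close>, so being orthogonal to it in the real part suffices.\<close>

lemma complex_orthogonal_decomposition:
  fixes K :: "'h::chilbert_space set" and x :: 'h
  assumes K: "closed_csubspace K"
  obtains y where "y \<in> K" "\<And>z. z \<in> K \<Longrightarrow> cinner (x - y) z = 0"
proof -
  obtain y where y: "y \<in> K" "\<And>z. z \<in> K \<Longrightarrow> inner (x - y) z = 0"
    using K orthogonal_decomposition[of K x] unfolding closed_csubspace_def by metis
  have "cinner (x - y) z = 0" if z: "z \<in> K" for z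
  proof -
    have "\<i> *\<^sub>C z \<in> K" using K z by (simp add: closed_csubspace_def)
    then have "Re (cinner (x - y) (\<i> *\<^sub>C z)) = 0"
      using y(2) by (simp add: inner_Re_cinner[symmetric])
    moreover have "Re (cinner (x - y) z) = 0"
      using y(2)[OF z] by (simp add: inner_Re_cinner)
    ultimately show ?thesis by (intro complex_eqI) (simp_all add: cinner_scaleC_right)
  qed
  with y(1) show ?thesis by (rule that)
qed

text \<open>Riesz representation of the real part of \<open>x \<mapsto> \<langle>T x, y\<rangle>\<close> already gives the
  complex adjoint, because a complex-linear functional is determined by its real part.\<close>

lemma cinner_cadjoint:
  fixes T :: "'h::chilbert_space \<Rightarrow> 'h"
  assumes T: "bounded_clinear T"
  shows "cinner (T x) y = cinner x (cadjoint T y)"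
proof -
  have T_lin: "bounded_linear T" and T_scale: "T (a *\<^sub>C x) = a *\<^sub>C T x" for a x
    using T by (auto simp: bounded_clinear_def)
  have "\<exists>z. \<forall>x. cinner (T x) y = cinner x z" for y
  proof -
    have "bounded_linear (\<lambda>x. inner (T x) y)"
      by (rule bounded_linear_compose[OF bounded_linear_inner_left T_lin])
    then obtain z where z: "\<And>x. inner (T x) y = inner x z"
      using riesz_representation_real by blast
    have "cinner (T x) y = cinner x z" for x
      by (rule cinner_eq_from_Re) (metis T_scale z inner_Re_cinner)
    then show ?thesis by blast
  qed
  then obtain S where S: "\<forall>x y. cinner (T x) y = cinner x (S y)" by metis
  have "(THE S. \<forall>x y. cinner (T x) y = cinner x (S y)) = S"
  proof (rule the_equality)
    show "\<forall>x y. cinner (T x) y = cinner x (S y)" by (rule S)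
  next
    fix S' assume "\<forall>x y. cinner (T x) y = cinner x (S' y)"
    with S show "S' = S" by (metis cinner_ext_right ext)
  qed
  with S show ?thesis by (simp add: cadjoint_def)
qed

lemma cinner_cadjoint_left:
  fixes T :: "'h::chilbert_space \<Rightarrow> 'h"
  assumes "bounded_clinear T"
  shows "cinner (cadjoint T x) y = cinner x (T y)"
  by (metis assms cinner_cadjoint cinner_commute)

lemma bounded_clinear_simps:
  assumes "bounded_clinear T"
  shows "T (x + y) = T x + T y" "T (a *\<^sub>C x) = a *\<^sub>C T x"
  using assms linear_add bounded_linear.linear
  unfolding bounded_clinear_def by blast+

lemma cadjoint_simps:
  fixes T :: "'h::chilbert_space \<Rightarrow> 'h"
  assumes T: "bounded_clinear T"
  shows "cadjoint T (x + y) = cadjoint T x + cadjoint T y"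
    and "cadjoint T (x - y) = cadjoint T x - cadjoint T y"
    and "cadjoint T (a *\<^sub>C x) = a *\<^sub>C cadjoint T x"
  by (rule cinner_ext_left; simp add: cinner_cadjoint_left[OF T] cinner_add_left
      cinner_diff_left cinner_scaleC_left)+

lemma power2_norm_add:
  "(norm (x + y :: 'h::chilbert_space))\<^sup>2 = (norm x)\<^sup>2 + (norm y)\<^sup>2 + 2 * Re (cinner x y)"
  unfolding power2_norm_eq_inner inner_Re_cinner[symmetric]
  by (simp add: inner_add_left inner_add_right inner_commute)

section \<open>Parseval frames\<close>

lemma closed_csubspace_add:
  "closed_csubspace K \<Longrightarrow> x \<in> K \<Longrightarrow> y \<in> K \<Longrightarrow> x + y \<in> K"
  by (simp add: closed_csubspace_def subspace_add)

lemma closed_csubspace_diff: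
  "closed_csubspace K \<Longrightarrow> x \<in> K \<Longrightarrow> y \<in> K \<Longrightarrow> x - y \<in> K"
  by (simp add: closed_csubspace_def subspace_diff)

lemma parseval_frame_norm:
  assumes "parseval_frame cinner K I e" "x \<in> K"
  shows "((\<lambda>i. (cmod (cinner x (e i)))\<^sup>2) has_sum (norm x)\<^sup>2) I"
  using assms by (simp add: parseval_frame_def Re_cinner_self)

lemma parseval_frame_mem:
  "parseval_frame cinner K I e \<Longrightarrow> i \<in> I \<Longrightarrow> e i \<in> K"
  by (auto simp: parseval_frame_def)

text \<open>The part of a vector of \<open>K\<close> orthogonal to a closed subspace containing the frame has zero
  frame coefficients, hence norm \<open>0\<close> by Parseval's identity.\<close>

lemma closed_cspan_parseval_frame:
  assumes K: "closed_csubspace K" and e: "parseval_frame cinner K I e"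
  shows "closed_cspan (e ` I) = K"
proof
  show "closed_cspan (e ` I) \<subseteq> K"
    using K e by (auto simp: closed_cspan_def parseval_frame_def)
  have "x \<in> K'" if x: "x \<in> K" and K': "closed_csubspace K'" "e ` I \<subseteq> K'" for x K'
  proof -
    have KK': "closed_csubspace (K \<inter> K')"
      using K K'(1) by (auto simp: closed_csubspace_def subspace_inter)
    obtain y where y: "y \<in> K \<inter> K'" "\<And>z. z \<in> K \<inter> K' \<Longrightarrow> cinner (x - y) z = 0"
      using complex_orthogonal_decomposition[OF KK', of x] by blast
    have "cinner (x - y) (e i) = 0" if "i \<in> I" for i
      using that K' parseval_frame_mem[OF e] by (intro y(2)) auto
    then have "((\<lambda>i. (cmod (cinner (x - y) (e i)))\<^sup>2) has_sum 0) I"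
      by (intro has_sum_0) simp
    moreover have "((\<lambda>i. (cmod (cinner (x - y) (e i)))\<^sup>2) has_sum (norm (x - y))\<^sup>2) I"
      using y(1) x closed_csubspace_diff[OF K] by (intro parseval_frame_norm[OF e]) auto
    ultimately have "0 = (norm (x - y))\<^sup>2" by (rule has_sum_unique)
    then have "x = y" by simp
    with y(1) show ?thesis by simp
  qed
  then show "K \<subseteq> closed_cspan (e ` I)" by (auto simp: closed_cspan_def)
qed

section \<open>Expansions along a strongly disjoint tuple\<close>

(* Kept folded so that k \<in> {1..n} stays the literal side condition of the indexed facts below. *)
declare One_nat_def [simp del] atLeastAtMost_iff [simp del]

locale strongly_disjoint_family =
  fixes n :: nat and K :: "nat \<Rightarrow> 'h::chilbert_space set" and I :: "'i set"
    and e :: "nat \<Rightarrow> 'i \<Rightarrow> 'h"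
  assumes strongly_disjoint_frames: "strongly_disjoint_frames n K I e"
begin

lemma closed_K: "k \<in> {1..n} \<Longrightarrow> closed_csubspace (K k)"
  using strongly_disjoint_frames by (simp add: strongly_disjoint_frames_def)

lemma parseval_tuple:
  assumes f: "\<And>k. k \<in> {1..n} \<Longrightarrow> f k \<in> K k"
  shows "((\<lambda>i. (cmod (\<Sum>k=1..n. cinner (f k) (e k i)))\<^sup>2) has_sum
    (\<Sum>k=1..n. (norm (f k))\<^sup>2)) I"
proof -
  have "restrict f {1..n} \<in> direct_sum n K" using f by (auto simp: direct_sum_def)
  then have "((\<lambda>i. (cmod (cinner_sum n (restrict f {1..n}) (\<lambda>k\<in>{1..n}. e k i)))\<^sup>2) has_sum
      Re (cinner_sum n (restrict f {1..n}) (restrict f {1..n}))) I"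
    using strongly_disjoint_frames unfolding strongly_disjoint_frames_def parseval_frame_def
    by blast
  then show ?thesis by (simp add: cinner_sum_def Re_cinner_self)
qed

text \<open>The map taking a tuple to its frame coefficients is injective, being isometric.\<close>

lemma tuple_eq_0:
  assumes f: "\<And>k. k \<in> {1..n} \<Longrightarrow> f k \<in> K k"
    and orth: "\<And>i. i \<in> I \<Longrightarrow> (\<Sum>k=1..n. cinner (f k) (e k i)) = 0"
    and k: "k \<in> {1..n}"
  shows "f k = 0"
proof -
  have "((\<lambda>i. (cmod (\<Sum>k=1..n. cinner (f k) (e k i)))\<^sup>2) has_sum 0) I"
    by (intro has_sum_0) (simp add: orth)
  with parseval_tuple[of f, OF f] have "(\<Sum>k=1..n. (norm (f k))\<^sup>2) = 0"
    by (rule has_sum_unique)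
  then have "\<forall>k\<in>{1..n}. (norm (f k))\<^sup>2 = 0"
    by (subst (asm) sum_nonneg_eq_0_iff) auto
  with k show ?thesis by simp
qed

end

text \<open>Along a strongly disjoint tuple of frames \<open>e\<^sub>k\<close> for \<open>K\<^sub>k\<close>, and for \<open>u\<^sub>k\<^sup>*\<close> and \<open>v\<^sub>k\<^sup>*\<close> with values in
  \<open>K\<^sub>k\<close>, the coefficient sequences of \<open>x\<close> and \<open>y\<close> with respect to \<open>E(i) = \<Sum>\<^sub>k u\<^sub>k e\<^sub>k(i)\<close> and
  \<open>F(i) = \<Sum>\<^sub>k v\<^sub>k e\<^sub>k(i)\<close> have inner product \<open>\<langle>cross_operator n v u x, y\<rangle>\<close>; for \<open>u = v\<close> this is the
  frame operator of \<open>E\<close>.\<close>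

definition cross_operator ::
    "nat \<Rightarrow> (nat \<Rightarrow> 'h \<Rightarrow> 'h) \<Rightarrow> (nat \<Rightarrow> 'h \<Rightarrow> 'h) \<Rightarrow> 'h \<Rightarrow> 'h::chilbert_space" where
  "cross_operator n v u x = (\<Sum>k=1..n. v k (cadjoint (u k) x))"

lemma cinner_cross_operator:
  assumes "\<And>k. k \<in> {1..n} \<Longrightarrow> bounded_clinear (v k)"
  shows "cinner (cross_operator n v u x) y
    = (\<Sum>k=1..n. cinner (cadjoint (u k) x) (cadjoint (v k) y))"
  unfolding cross_operator_def cinner_sum_left
  by (intro sum.cong) (simp_all add: cinner_cadjoint assms)

text \<open>The assumption \<open>cadjoint_mem\<close> makes the tuple of the \<open>u\<^sub>k\<^sup>* x\<close> a member of the direct sum, so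
  that the isometry of the strongly disjoint tuple applies to it.\<close>

locale frame_expansion = strongly_disjoint_family n K I e
  for n :: nat and K :: "nat \<Rightarrow> 'h::chilbert_space set" and I :: "'i set"
    and e :: "nat \<Rightarrow> 'i \<Rightarrow> 'h" +
  fixes u :: "nat \<Rightarrow> 'h \<Rightarrow> 'h" and E :: "'i \<Rightarrow> 'h" and L :: "'h set"
  assumes bounded: "\<And>k. k \<in> {1..n} \<Longrightarrow> bounded_clinear (u k)"
    and cadjoint_mem: "\<And>k x. k \<in> {1..n} \<Longrightarrow> cadjoint (u k) x \<in> K k"
    and expansion: "\<And>i. i \<in> I \<Longrightarrow> E i = (\<Sum>k=1..n. u k (e k i))"
    and closed_span: "closed_csubspace L"
    and frame: "parseval_frame cinner L I E"
begin

lemma frame_coefficient: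
  assumes "i \<in> I"
  shows "cinner x (E i) = (\<Sum>k=1..n. cinner (cadjoint (u k) x) (e k i))"
  unfolding expansion[OF assms] cinner_sum_right
  by (intro sum.cong) (simp_all add: cinner_cadjoint_left bounded)

lemma cinner_cross:
  "cinner (cross_operator n u w x) y = (\<Sum>k=1..n. cinner (cadjoint (w k) x) (cadjoint (u k) y))"
  by (rule cinner_cross_operator) (rule bounded)

lemma cadjoint_norm:
  assumes "x \<in> L"
  shows "(\<Sum>k=1..n. (norm (cadjoint (u k) x))\<^sup>2) = (norm x)\<^sup>2"
proof -
  have "((\<lambda>i. (cmod (cinner x (E i)))\<^sup>2) has_sum (\<Sum>k=1..n. (norm (cadjoint (u k) x))\<^sup>2)) I"
    using parseval_tuple[of "\<lambda>k. cadjoint (u k) x", OF cadjoint_mem]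
    by (simp add: frame_coefficient cong: has_sum_cong)
  then show ?thesis by (rule has_sum_unique[OF _ parseval_frame_norm[OF frame assms]])
qed

lemma cadjoint_eq_0:
  assumes "\<And>z. z \<in> L \<Longrightarrow> cinner x z = 0" "k \<in> {1..n}"
  shows "cadjoint (u k) x = 0"
proof (rule tuple_eq_0[where f = "\<lambda>k. cadjoint (u k) x", OF cadjoint_mem _ assms(2)])
  fix i assume "i \<in> I"
  then show "(\<Sum>k=1..n. cinner (cadjoint (u k) x) (e k i)) = 0"
    using assms(1) parseval_frame_mem[OF frame] frame_coefficient by metis
qed

text \<open>The operator \<open>\<Sum>\<^sub>k u\<^sub>k u\<^sub>k\<^sup>*\<close> is the frame operator of \<open>E\<close>, hence the projection onto \<open>L\<close>;
  polarising the norm identity on \<open>L\<close> and using that the \<open>u\<^sub>k\<^sup>*\<close> vanish on the orthogonal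
  complement of \<open>L\<close> shows this without summing the frame.\<close>

lemma cross_operator_self:
  assumes x: "x \<in> L"
  shows "cross_operator n u u x = x"
proof -
  have on_L: "Re (cinner (cross_operator n u u x) y) = Re (cinner x y)" if y: "y \<in> L" for y
  proof -
    have "(norm (x + y))\<^sup>2 = (\<Sum>k=1..n. (norm (cadjoint (u k) x + cadjoint (u k) y))\<^sup>2)"
      unfolding cadjoint_norm[OF closed_csubspace_add[OF closed_span x y], symmetric]
      by (intro sum.cong) (simp_all add: cadjoint_simps bounded)
    also have "\<dots> = (norm x)\<^sup>2 + (norm y)\<^sup>2 + 2 * Re (cinner (cross_operator n u u x) y)"
      by (simp add: power2_norm_add sum.distrib cadjoint_norm x y cinner_cross
          sum_distrib_left)
    finally show ?thesis by (simp add: power2_norm_add)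
  qed
  have "Re (cinner (cross_operator n u u x) y) = Re (cinner x y)" for y
  proof -
    obtain a where a: "a \<in> L" "\<And>z. z \<in> L \<Longrightarrow> cinner (y - a) z = 0"
      using complex_orthogonal_decomposition[OF closed_span, of y] by blast
    have "cinner x (y - a) = 0" using a(2)[OF x] cinner_commute[of x "y - a"] by simp
    moreover have "cinner (cross_operator n u u x) (y - a) = 0"
      by (simp add: cinner_cross cadjoint_eq_0[OF a(2)])
    ultimately show ?thesis using on_L[OF a(1)] by (simp add: cinner_diff_right)
  qed
  then have "(norm (cross_operator n u u x - x))\<^sup>2 = 0"
    by (subst Re_cinner_self[symmetric]) (simp only: cinner_diff_left minus_complex.sel diff_self)
  then show ?thesis by simp
qed

text \<open>The component of a value orthogonal to \<open>L\<close> is killed by every \<open>u\<^sub>k\<^sup>*\<close>, hence orthogonal to all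
  values \<open>\<Sum>\<^sub>k u\<^sub>k w\<^sub>k\<^sup>* x\<close>, in particular to the value it came from.\<close>

lemma cross_operator_mem: "cross_operator n u w x \<in> L"
proof -
  obtain a where a: "a \<in> L" "\<And>z. z \<in> L \<Longrightarrow> cinner (cross_operator n u w x - a) z = 0"
    using complex_orthogonal_decomposition[OF closed_span] by blast
  let ?b = "cross_operator n u w x - a"
  have "cinner (cross_operator n u w x) ?b = 0"
    by (simp add: cinner_cross cadjoint_eq_0[OF a(2)])
  moreover have "cinner a ?b = 0" using a(2)[OF a(1)] cinner_commute[of a ?b] by simp
  ultimately have "cinner ?b ?b = 0" by (simp only: cinner_diff_left diff_self)
  then have "?b = 0" by (simp only: cinner_self) simp
  with a(1) show ?thesis by simp
qed

lemma cross_operator_on_span: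
  obtains y where "y \<in> L" "cross_operator n w u x = cross_operator n w u y"
proof -
  obtain y where y: "y \<in> L" "\<And>z. z \<in> L \<Longrightarrow> cinner (x - y) z = 0"
    using complex_orthogonal_decomposition[OF closed_span, of x] by blast
  have "cadjoint (u k) x = cadjoint (u k) y" if k: "k \<in> {1..n}" for k
    using cadjoint_eq_0[OF y(2) k] by (simp add: cadjoint_simps bounded[OF k])
  then have "cross_operator n w u x = cross_operator n w u y" by (simp add: cross_operator_def)
  with y(1) show ?thesis by (rule that)
qed

end

section \<open>Strong disjointness and unitary equivalence of two expansions\<close>

locale frame_expansion_pair =
  E: frame_expansion n K I e u E L + F: frame_expansion n K I e v F M
  for n :: nat and K :: "nat \<Rightarrow> 'h::chilbert_space set" and I :: "'i set"
    and e :: "nat \<Rightarrow> 'i \<Rightarrow> 'h" and u E L v F M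
begin

text \<open>The cross term left over when Parseval's identity for the tuple is compared with those
  for \<open>E\<close> and \<open>F\<close> separately; it measures the failure of strong disjointness.\<close>

lemma sum_frame_coefficients:
  assumes x: "x \<in> L" and y: "y \<in> M"
  shows "((\<lambda>i. (cmod (cinner x (E i) + cinner y (F i)))\<^sup>2) has_sum
    ((norm x)\<^sup>2 + (norm y)\<^sup>2 + 2 * Re (cinner (cross_operator n v u x) y))) I"
proof -
  let ?f = "\<lambda>k. cadjoint (u k) x + cadjoint (v k) y"
  have pf: "((\<lambda>i. (cmod (\<Sum>k=1..n. cinner (?f k) (e k i)))\<^sup>2) has_sum
      (\<Sum>k=1..n. (norm (?f k))\<^sup>2)) I"
    by (intro E.parseval_tuple closed_csubspace_add E.closed_K E.cadjoint_mem F.cadjoint_mem)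
  have norms: "(\<Sum>k=1..n. (norm (?f k))\<^sup>2)
      = (norm x)\<^sup>2 + (norm y)\<^sup>2 + 2 * Re (cinner (cross_operator n v u x) y)"
    by (simp add: power2_norm_add sum.distrib E.cadjoint_norm F.cadjoint_norm x y
        F.cinner_cross sum_distrib_left)
  have "(\<Sum>k=1..n. cinner (?f k) (e k i)) = cinner x (E i) + cinner y (F i)"
    if "i \<in> I" for i
    by (simp add: E.frame_coefficient F.frame_coefficient that cinner_add_left sum.distrib)
  then show ?thesis using pf unfolding norms by (simp cong: has_sum_cong)
qed

text \<open>Vanishing of \<open>Re \<langle>W x, y\<rangle>\<close> for \<open>x \<in> L\<close> and \<open>y \<in> M\<close> forces \<open>W = 0\<close>: every value of \<open>W\<close> is already
  attained at some \<open>x \<in> L\<close>, and \<open>y = W x\<close> is an admissible choice in \<open>M\<close>.\<close>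

theorem strongly_disjoint_iff:
  "strongly_disjoint_frames 2 (\<lambda>k. if k = 1 then L else M) I (\<lambda>k. if k = 1 then E else F)
    \<longleftrightarrow> (\<forall>x. cross_operator n v u x = 0)" (is "?sd \<longleftrightarrow> _")
proof -
  let ?K = "\<lambda>k::nat. if k = 1 then L else M"
  let ?e = "\<lambda>i. \<lambda>k\<in>{1..2::nat}. (if k = 1 then E else F) i"
  have two: "{1..2::nat} = {1, 2}" by (auto simp: atLeastAtMost_iff)
  have coeff: "cinner_sum 2 f (?e i) = cinner (f 1) (E i) + cinner (f 2) (F i)" for f i
    by (simp add: cinner_sum_def two)
  have sqnorm: "Re (cinner_sum 2 f f) = (norm (f 1))\<^sup>2 + (norm (f 2))\<^sup>2" for f :: "nat \<Rightarrow> 'h"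
    by (simp add: cinner_sum_def two Re_cinner_self)
  have mem: "?e i \<in> direct_sum 2 ?K" if "i \<in> I" for i
    using parseval_frame_mem[OF E.frame that] parseval_frame_mem[OF F.frame that]
    by (auto simp: direct_sum_def two)
  have "?sd \<longleftrightarrow> parseval_frame (cinner_sum 2) (direct_sum 2 ?K) I ?e"
    using E.closed_span F.closed_span E.frame F.frame
    by (auto simp: strongly_disjoint_frames_def two)
  also have "\<dots> \<longleftrightarrow> (\<forall>x\<in>L. \<forall>y\<in>M. Re (cinner (cross_operator n v u x) y) = 0)"
  proof
    assume pf: "parseval_frame (cinner_sum 2) (direct_sum 2 ?K) I ?e"
    show "\<forall>x\<in>L. \<forall>y\<in>M. Re (cinner (cross_operator n v u x) y) = 0"
    proof (intro ballI)
      fix x y assume xy: "x \<in> L" "y \<in> M"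
      let ?f = "\<lambda>k\<in>{1..2::nat}. if k = 1 then x else y"
      have "?f \<in> direct_sum 2 ?K" using xy by (auto simp: direct_sum_def two)
      then have "((\<lambda>i. (cmod (cinner_sum 2 ?f (?e i)))\<^sup>2) has_sum Re (cinner_sum 2 ?f ?f)) I"
        using pf unfolding parseval_frame_def by blast
      then have "((\<lambda>i. (cmod (cinner x (E i) + cinner y (F i)))\<^sup>2) has_sum
          ((norm x)\<^sup>2 + (norm y)\<^sup>2)) I"
        unfolding coeff sqnorm by (simp add: two)
      from has_sum_unique[OF this sum_frame_coefficients[OF xy]]
      show "Re (cinner (cross_operator n v u x) y) = 0" by simp
    qed
  next
    assume orth: "\<forall>x\<in>L. \<forall>y\<in>M. Re (cinner (cross_operator n v u x) y) = 0"
    have "((\<lambda>i. (cmod (cinner_sum 2 f (?e i)))\<^sup>2) has_sum Re (cinner_sum 2 f f)) I"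
      if f: "f \<in> direct_sum 2 ?K" for f
    proof -
      have "f 1 \<in> L" "f 2 \<in> M"
        using PiE_mem[OF f[unfolded direct_sum_def], of 1] PiE_mem[OF f[unfolded direct_sum_def], of 2]
        by (simp_all add: two)
      then show ?thesis
        unfolding coeff sqnorm using sum_frame_coefficients[of "f 1" "f 2"] orth by simp
    qed
    with mem show "parseval_frame (cinner_sum 2) (direct_sum 2 ?K) I ?e"
      by (auto simp: parseval_frame_def)
  qed
  also have "\<dots> \<longleftrightarrow> (\<forall>x. cross_operator n v u x = 0)"
  proof
    assume orth: "\<forall>x\<in>L. \<forall>y\<in>M. Re (cinner (cross_operator n v u x) y) = 0"
    show "\<forall>x. cross_operator n v u x = 0"
    proof
      fix x
      obtain y where y: "y \<in> L" "cross_operator n v u x = cross_operator n v u y"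
        using E.cross_operator_on_span by blast
      have "Re (cinner (cross_operator n v u y) (cross_operator n v u y)) = 0"
        using orth y(1) F.cross_operator_mem by blast
      then show "cross_operator n v u x = 0" by (simp add: y(2) Re_cinner_self)
    qed
  qed simp
  finally show ?thesis .
qed

text \<open>Unitary equivalence yields \<open>\<langle>F(i), F(j)\<rangle> = \<langle>E(i), E(j)\<rangle>\<close>.  Reading the frame coefficients along the
  tuple as functions of one index at a time removes first \<open>e\<^sub>k(j)\<close> and then \<open>e\<^sub>l(i)\<close> from this equation
  and leaves the operators.\<close>

lemma unitarily_equivalent_imp_gram_operators_eq:
  assumes U: "unitary_on L M U" "\<And>i. i \<in> I \<Longrightarrow> U (E i) = F i"
    and k: "k \<in> {1..n}" and l: "l \<in> {1..n}"
  shows "cadjoint (u k) (u l x) = cadjoint (v k) (v l x)"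
proof -
  have gram: "cinner (F i) (F j) = cinner (E i) (E j)" if "i \<in> I" "j \<in> I" for i j
    using U that parseval_frame_mem[OF E.frame] unfolding unitary_on_def by metis
  (* By equality of the Gram matrices the tuple of these differences has zero coefficients. *)
  have eq: "cadjoint (u k) (E i) = cadjoint (v k) (F i)" if i: "i \<in> I" and k: "k \<in> {1..n}" for i k
  proof -
    have "cadjoint (u k) (E i) - cadjoint (v k) (F i) = 0"
    proof (rule E.tuple_eq_0[where f = "\<lambda>k. cadjoint (u k) (E i) - cadjoint (v k) (F i)", OF _ _ k])
      show "cadjoint (u k) (E i) - cadjoint (v k) (F i) \<in> K k" if "k \<in> {1..n}" for k
        using that by (intro closed_csubspace_diff E.closed_K E.cadjoint_mem F.cadjoint_mem)
    next
      fix j assume j: "j \<in> I"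
      have "(\<Sum>k=1..n. cinner (cadjoint (u k) (E i) - cadjoint (v k) (F i)) (e k j))
          = cinner (E i) (E j) - cinner (F i) (F j)"
        by (simp add: cinner_diff_left sum_subtractf E.frame_coefficient[OF j]
            F.frame_coefficient[OF j])
      then show "(\<Sum>k=1..n. cinner (cadjoint (u k) (E i) - cadjoint (v k) (F i)) (e k j)) = 0"
        using gram i j by simp
    qed
    then show ?thesis by simp
  qed
  (* Moving u l and v l to the other side gives the coefficients of this tuple from eq. *)
  have "cadjoint (u k) (u l x) - cadjoint (v k) (v l x) = 0"
  proof (rule E.tuple_eq_0[where f = "\<lambda>k. cadjoint (u k) (u l x) - cadjoint (v k) (v l x)", OF _ _ k])
    show "cadjoint (u k) (u l x) - cadjoint (v k) (v l x) \<in> K k" if "k \<in> {1..n}" for k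
      using that by (intro closed_csubspace_diff E.closed_K E.cadjoint_mem F.cadjoint_mem)
  next
    fix j assume j: "j \<in> I"
    have "(\<Sum>k=1..n. cinner (cadjoint (u k) (u l x) - cadjoint (v k) (v l x)) (e k j))
        = cinner (u l x) (E j) - cinner (v l x) (F j)"
      by (simp add: cinner_diff_left sum_subtractf E.frame_coefficient[OF j]
          F.frame_coefficient[OF j])
    also have "\<dots> = cinner x (cadjoint (u l) (E j)) - cinner x (cadjoint (v l) (F j))"
      using l by (simp add: cinner_cadjoint E.bounded F.bounded)
    finally show "(\<Sum>k=1..n. cinner (cadjoint (u k) (u l x) - cadjoint (v k) (v l x)) (e k j)) = 0"
      using eq[OF j l] by simp
  qed
  then show ?thesis by simp
qed

text \<open>In \<open>\<Sum>\<^sub>k \<Sum>\<^sub>l v\<^sub>k u\<^sub>k\<^sup>* u\<^sub>l w\<^sub>l\<^sup>* x\<close> the inner factor \<open>u\<^sub>k\<^sup>* u\<^sub>l\<close> may be replaced by \<open>v\<^sub>k\<^sup>* v\<^sub>l\<close>.  With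
  \<open>w = v\<close> the right-hand side is the square of the projection onto \<open>M\<close>, so the cross operator from
  \<open>M\<close> to \<open>L\<close> is a right inverse of the one from \<open>L\<close> to \<open>M\<close>.\<close>

lemma cross_operator_compose:
  assumes gram: "\<And>k l x. k \<in> {1..n} \<Longrightarrow> l \<in> {1..n} \<Longrightarrow>
    cadjoint (u k) (u l x) = cadjoint (v k) (v l x)"
  shows "cross_operator n v u (cross_operator n u w x) = cross_operator n v v (cross_operator n v w x)"
proof -
  have "cadjoint (u k) (cross_operator n u w x) = cadjoint (v k) (cross_operator n v w x)"
    if k: "k \<in> {1..n}" for k
  proof (rule cinner_ext_left)
    fix z
    have "cinner (cadjoint (u k) (cross_operator n u w x)) z
        = (\<Sum>l=1..n. cinner (cadjoint (u k) (u l (cadjoint (w l) x))) z)"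
      by (simp add: cinner_cadjoint_left E.bounded k cross_operator_def cinner_sum_left)
    also have "\<dots> = (\<Sum>l=1..n. cinner (cadjoint (v k) (v l (cadjoint (w l) x))) z)"
      by (intro sum.cong) (simp_all add: gram k)
    also have "\<dots> = cinner (cadjoint (v k) (cross_operator n v w x)) z"
      by (simp add: cinner_cadjoint_left F.bounded k cross_operator_def cinner_sum_left)
    finally show "cinner (cadjoint (u k) (cross_operator n u w x)) z
        = cinner (cadjoint (v k) (cross_operator n v w x)) z" .
  qed
  then show ?thesis unfolding cross_operator_def[of n v u] cross_operator_def[of n v v] by simp
qed

text \<open>Replacing \<open>v\<^sub>k\<^sup>* v\<^sub>l\<close> by \<open>u\<^sub>k\<^sup>* u\<^sub>l\<close> in \<open>\<langle>W x, W y\<rangle>\<close> gives \<open>\<langle>P x, P y\<rangle>\<close> with the projection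
  \<open>P = \<Sum>\<^sub>k u\<^sub>k u\<^sub>k\<^sup>*\<close> onto \<open>L\<close>, and \<open>u\<^sub>k\<^sup>* E(i) = v\<^sub>k\<^sup>* F(i)\<close> turns \<open>W E(i)\<close> into the projection of \<open>F(i)\<close>
  onto \<open>M\<close>.\<close>

lemma unitary_cross_operator:
  assumes gram: "\<And>k l x. k \<in> {1..n} \<Longrightarrow> l \<in> {1..n} \<Longrightarrow>
    cadjoint (u k) (u l x) = cadjoint (v k) (v l x)"
  shows "unitary_on L M (cross_operator n v u)"
    and "i \<in> I \<Longrightarrow> cross_operator n v u (E i) = F i"
proof -
  have isometric: "cinner (cross_operator n v u x) (cross_operator n v u y) = cinner x y"
    if x: "x \<in> L" and y: "y \<in> L" for x y
  proof -
    have "cinner (cross_operator n v u x) (cross_operator n v u y)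
        = (\<Sum>k=1..n. \<Sum>l=1..n. cinner (v l (cadjoint (u l) x)) (v k (cadjoint (u k) y)))"
      by (simp add: cross_operator_def cinner_sum_left cinner_sum_right)
    also have "\<dots> = (\<Sum>k=1..n. \<Sum>l=1..n. cinner (u l (cadjoint (u l) x)) (u k (cadjoint (u k) y)))"
    proof (intro sum.cong refl)
      fix k l assume k: "k \<in> {1..n}" and l: "l \<in> {1..n}"
      show "cinner (v l (cadjoint (u l) x)) (v k (cadjoint (u k) y))
          = cinner (u l (cadjoint (u l) x)) (u k (cadjoint (u k) y))"
        unfolding cinner_cadjoint_left[OF E.bounded[OF k], symmetric]
          cinner_cadjoint_left[OF F.bounded[OF k], symmetric] gram[OF k l] ..
    qed
    also have "\<dots> = cinner (cross_operator n u u x) (cross_operator n u u y)"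
      by (simp add: cross_operator_def cinner_sum_left cinner_sum_right)
    finally show ?thesis by (simp add: E.cross_operator_self x y)
  qed
  have add: "cross_operator n v u (x + y) = cross_operator n v u x + cross_operator n v u y" for x y
    unfolding cross_operator_def sum.distrib[symmetric]
    by (intro sum.cong) (simp_all add: cadjoint_simps bounded_clinear_simps E.bounded F.bounded)
  have scale: "cross_operator n v u (a *\<^sub>C x) = a *\<^sub>C cross_operator n v u x" for a x
  proof (rule cinner_ext_left)
    fix y
    show "cinner (cross_operator n v u (a *\<^sub>C x)) y = cinner (a *\<^sub>C cross_operator n v u x) y"
      unfolding cross_operator_def cinner_scaleC_left cinner_sum_left sum_distrib_left
      by (intro sum.cong) (simp_all add: cadjoint_simps bounded_clinear_simps E.bounded F.bounded
          cinner_scaleC_left)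
  qed
  have "y \<in> cross_operator n v u ` L" if y: "y \<in> M" for y
  proof -
    have "cross_operator n v u (cross_operator n u v y) = y"
      using cross_operator_compose[OF gram] by (simp add: F.cross_operator_self y)
    then show ?thesis using E.cross_operator_mem[of v y] by (metis imageI)
  qed
  then have "cross_operator n v u ` L = M" using F.cross_operator_mem by blast
  then show "unitary_on L M (cross_operator n v u)"
    using add scale isometric by (simp add: unitary_on_def)
  assume i: "i \<in> I"
  have "cadjoint (u k) (E i) = cadjoint (v k) (F i)" if k: "k \<in> {1..n}" for k
  proof (rule cinner_ext_left)
    fix z
    have "cinner (cadjoint (u k) (E i)) z = (\<Sum>l=1..n. cinner (cadjoint (u k) (u l (e l i))) z)"
      by (simp add: cinner_cadjoint_left E.bounded k E.expansion i cinner_sum_left)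
    also have "\<dots> = (\<Sum>l=1..n. cinner (cadjoint (v k) (v l (e l i))) z)"
      by (intro sum.cong) (simp_all add: gram k)
    also have "\<dots> = cinner (cadjoint (v k) (F i)) z"
      by (simp add: cinner_cadjoint_left F.bounded k F.expansion i cinner_sum_left)
    finally show "cinner (cadjoint (u k) (E i)) z = cinner (cadjoint (v k) (F i)) z" .
  qed
  then have "cross_operator n v u (E i) = cross_operator n v v (F i)"
    by (simp add: cross_operator_def)
  then show "cross_operator n v u (E i) = F i"
    by (simp add: F.cross_operator_self parseval_frame_mem[OF F.frame i])
qed

theorem unitarily_equivalent_iff:
  "unitarily_equivalent_frames L M I E F \<longleftrightarrow>
    (\<forall>k\<in>{1..n}. \<forall>l\<in>{1..n}. cadjoint (u k) \<circ> u l = cadjoint (v k) \<circ> v l)"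
  (is "?equiv \<longleftrightarrow> ?gram")
proof
  assume ?equiv
  then show ?gram
    unfolding unitarily_equivalent_frames_def
    using unitarily_equivalent_imp_gram_operators_eq by (auto simp: fun_eq_iff)
next
  assume ?gram
  then have gram: "cadjoint (u k) (u l x) = cadjoint (v k) (v l x)"
    if "k \<in> {1..n}" "l \<in> {1..n}" for k l x
    using that by (metis comp_apply)
  show ?equiv
    unfolding unitarily_equivalent_frames_def
    using E.closed_span E.frame F.closed_span F.frame unitary_cross_operator[OF gram] by blast
qed

end

section \<open>Frame vectors of a representation\<close>

lemma orbit_space_eq:
  assumes "parseval_frame_vector G \<pi> K \<xi>"
  shows "orbit_space G \<pi> \<xi> = K"
  using assms closed_cspan_parseval_frame
  unfolding parseval_frame_vector_def orbit_space_def by blast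

text \<open>Commutation of \<open>u\<^sub>k\<close> with \<open>\<pi>(g)\<close> carries the expansion of \<open>\<eta>\<close> along its whole orbit.\<close>

lemma frame_vector_expansion:
  fixes \<pi> :: "'g \<Rightarrow> 'h::chilbert_space \<Rightarrow> 'h"
  assumes \<pi>: "\<pi> \<in> hom G unitary_group"
    and sd: "strongly_disjoint_tuple G \<pi> n \<xi>"
    and u: "\<And>k. k \<in> {1..n} \<Longrightarrow> u k \<in> commutant G \<pi>"
    and u_mem: "\<And>k x. k \<in> {1..n} \<Longrightarrow> cadjoint (u k) x \<in> orbit_space G \<pi> (\<xi> k)"
    and \<eta>: "\<eta> = (\<Sum>k=1..n. u k (\<xi> k))"
    and frame: "parseval_frame_vector G \<pi> K \<eta>"
  shows "frame_expansion n (\<lambda>k. orbit_space G \<pi> (\<xi> k)) (carrier G) (\<lambda>k g. \<pi> g (\<xi> k))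
    u (\<lambda>g. \<pi> g \<eta>) (orbit_space G \<pi> \<eta>)"
proof
  show "strongly_disjoint_frames n (\<lambda>k. orbit_space G \<pi> (\<xi> k)) (carrier G) (\<lambda>k g. \<pi> g (\<xi> k))"
    using sd by (simp add: strongly_disjoint_tuple_def)
  show "bounded_clinear (u k)" if "k \<in> {1..n}" for k
    using u[OF that] by (simp add: commutant_def)
  show "\<pi> g \<eta> = (\<Sum>k=1..n. u k (\<pi> g (\<xi> k)))" if g: "g \<in> carrier G" for g
  proof -
    have "unitary_on UNIV UNIV (\<pi> g)"
      using \<pi> g by (auto simp: hom_def unitary_group_def)
    then have "Modules.additive (\<pi> g)"
      by (simp add: unitary_on_def Modules.additive_def)
    then have "\<pi> g \<eta> = (\<Sum>k=1..n. \<pi> g (u k (\<xi> k)))" unfolding \<eta> by (rule Modules.additive.sum)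
    also have "\<dots> = (\<Sum>k=1..n. u k (\<pi> g (\<xi> k)))"
      using u g by (intro sum.cong) (auto simp: commutant_def fun_eq_iff)
    finally show ?thesis .
  qed
qed (use u_mem frame orbit_space_eq[OF frame] in \<open>auto simp: parseval_frame_vector_def\<close>)

text \<open>Taking adjoints in \<open>T p = T\<close> gives \<open>p T\<^sup>* = T\<^sup>*\<close>.\<close>

lemma cadjoint_in_range_projection:
  fixes T p :: "'h::chilbert_space \<Rightarrow> 'h"
  assumes T: "bounded_clinear T" and p: "orth_projection p" and Tp: "T \<circ> p = T"
  shows "cadjoint T x \<in> range p"
proof -
  have "cadjoint T x = p (cadjoint T x)"
  proof (rule cinner_ext_right)
    fix y
    have "cinner y (cadjoint T x) = cinner (T (p y)) x"
      using Tp by (simp add: cinner_cadjoint[OF T, symmetric] fun_eq_iff)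
    also have "\<dots> = cinner y (p (cadjoint T x))"
      using p cinner_cadjoint[of p] by (simp add: cinner_cadjoint[OF T] orth_projection_def)
    finally show "cinner y (cadjoint T x) = cinner y (p (cadjoint T x))" .
  qed
  then show ?thesis by (metis rangeI)
qed

theorem theorem2p7:
  fixes G :: "('g, 'm) monoid_scheme"
    and \<pi> :: "'g \<Rightarrow> 'h::chilbert_space \<Rightarrow> 'h"
    and N :: nat
    and \<xi> :: "nat \<Rightarrow> 'h"
    and p :: "'h \<Rightarrow> 'h"
    and \<eta> \<zeta> :: 'h
    and u v :: "nat \<Rightarrow> 'h \<Rightarrow> 'h"
  assumes "icc_group G"
    and "countable (carrier G)"
    and "\<pi> \<in> hom G unitary_group"
    and "\<exists>x::'h. x \<noteq> 0"
    and "parseval_frame_vector G \<pi> UNIV (\<xi> 1)"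
    and "int N = \<lfloor>1 / (norm (\<xi> 1))\<^sup>2\<rfloor>"
    and "strongly_disjoint_tuple G \<pi> (N + 1) \<xi>"
    and "\<And>k. k \<in> {1..N} \<Longrightarrow> parseval_frame_vector G \<pi> UNIV (\<xi> k)"
    and "(norm (\<xi> (N + 1)))\<^sup>2 = 1 - real N * (norm (\<xi> 1))\<^sup>2"
    and "p \<in> commutant G \<pi>"
    and "orth_projection p"
    and "parseval_frame_vector G \<pi> (range p) (\<xi> (N + 1))"
    and "\<exists>K. parseval_frame_vector G \<pi> K \<eta>"
    and "\<exists>L. parseval_frame_vector G \<pi> L \<zeta>"
    and "\<And>k. k \<in> {1..N + 1} \<Longrightarrow> u k \<in> commutant G \<pi>"
    and "\<And>k. k \<in> {1..N + 1} \<Longrightarrow> v k \<in> commutant G \<pi>"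
    and "u (N + 1) \<circ> p = u (N + 1)"
    and "v (N + 1) \<circ> p = v (N + 1)"
    and "\<eta> = (\<Sum>k=1..N + 1. u k (\<xi> k))"
    and "\<zeta> = (\<Sum>k=1..N + 1. v k (\<xi> k))"
  shows "(strongly_disjoint G \<pi> \<eta> \<zeta> \<longleftrightarrow>
            (\<forall>x. (\<Sum>k=1..N + 1. (v k \<circ> cadjoint (u k)) x) = 0)) \<and>
         (unitarily_equivalent G \<pi> \<eta> \<zeta> \<longleftrightarrow>
            (\<forall>i\<in>{1..N + 1}. \<forall>j\<in>{1..N + 1}.
               cadjoint (u i) \<circ> u j = cadjoint (v i) \<circ> v j))"
proof -
  have orbit_full: "orbit_space G \<pi> (\<xi> k) = UNIV" if "k \<in> {1..N}" for k
    using assms(8)[OF that] by (rule orbit_space_eq)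
  have orbit_last: "orbit_space G \<pi> (\<xi> (N + 1)) = range p"
    using assms(12) by (rule orbit_space_eq)
  have adj_mem: "cadjoint (w k) x \<in> orbit_space G \<pi> (\<xi> k)"
    if w: "\<And>k. k \<in> {1..N + 1} \<Longrightarrow> w k \<in> commutant G \<pi>" "w (N + 1) \<circ> p = w (N + 1)"
      and k: "k \<in> {1..N + 1}" for w k x
  proof (cases "k = N + 1")
    case True
    have "bounded_clinear (w (N + 1))" using w(1)[OF k] True by (simp add: commutant_def)
    then show ?thesis
      unfolding True orbit_last using assms(11) w(2) by (rule cadjoint_in_range_projection)
  next
    case False
    then show ?thesis using k by (simp add: orbit_full atLeastAtMost_iff)
  qed
  have u_mem: "cadjoint (u k) x \<in> orbit_space G \<pi> (\<xi> k)"
    and v_mem: "cadjoint (v k) x \<in> orbit_space G \<pi> (\<xi> k)" if "k \<in> {1..N + 1}" for k x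
    using adj_mem[of u k] adj_mem[of v k] assms(15-18) that by blast+
  obtain K L where K: "parseval_frame_vector G \<pi> K \<eta>" and L: "parseval_frame_vector G \<pi> L \<zeta>"
    using assms(13,14) by blast
  interpret frame_expansion_pair "N + 1" "\<lambda>k. orbit_space G \<pi> (\<xi> k)" "carrier G"
    "\<lambda>k g. \<pi> g (\<xi> k)" u "\<lambda>g. \<pi> g \<eta>" "orbit_space G \<pi> \<eta>" v "\<lambda>g. \<pi> g \<zeta>" "orbit_space G \<pi> \<zeta>"
    unfolding frame_expansion_pair_def
    using frame_vector_expansion[OF assms(3) assms(7) assms(15) u_mem assms(19) K]
      frame_vector_expansion[OF assms(3) assms(7) assms(16) v_mem assms(20) L]
    by blast
  have "strongly_disjoint G \<pi> \<eta> \<zeta> \<longleftrightarrow> strongly_disjoint_frames 2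
      (\<lambda>k. if k = 1 then orbit_space G \<pi> \<eta> else orbit_space G \<pi> \<zeta>) (carrier G)
      (\<lambda>k. if k = 1 then (\<lambda>g. \<pi> g \<eta>) else (\<lambda>g. \<pi> g \<zeta>))"
    unfolding strongly_disjoint_def strongly_disjoint_tuple_def
    by (intro arg_cong2[where f = "\<lambda>K e. strongly_disjoint_frames 2 K (carrier G) e"])
      (auto simp: fun_eq_iff)
  then show ?thesis
    using strongly_disjoint_iff unitarily_equivalent_iff
    by (simp add: cross_operator_def unitarily_equivalent_def)
qed

end
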